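(* Let $n,d\in\mathbb{N}$, $\sigma>0$, $\delta\in(0,1/4]$, $\Theta:=\mathbb{R}^d$ and, for $\theta\in\Theta$, $$\mathcal{P}_\theta:=\bigl\{\mathsf{N}_d(\theta,\Sigma)^{\otimes n}:\Sigma\in\mathcal{S}_{++}^{d\times d},\ \|\Sigma\|_\infty\le\sigma^2\bigr\}.$$ Then, for the loss $L(\theta,\theta')=\|\theta-\theta'\|_\infty$, $$\mathcal{M}(\delta,\mathcal{P}_\Theta,\|\cdot\|_\infty)\asymp\sigma\sqrt{\frac{\log(d/\delta)}{n}}.$$
   Context: $\mathcal{S}_{++}^{d\times d}$ is the set of symmetric positive definite $d\times d$ real matrices; $\|\Sigma\|_\infty:=\max_{i,j}|\Sigma_{ij}|$; for vectors, $\|v\|_\infty=\max_j|v_j|$. For a pseudo-metric space $\Theta$ of parameters (with its Borel $\sigma$-algebra), a family $\mathcal{P}_\Theta=\{\mathcal{P}_\theta:\theta\in\Theta\}$ where each $\mathcal{P}_\theta$ is a set of probability measures on a measurable space $\mathcal{X}$, and a loss $L:\Theta\times\Theta\to[0,\infty)$, the minimax $(1-\delta)$th quantile is $$\mathcal{M}(\delta,\mathcal{P}_\Theta,L):=\inf_{\hat\theta}\sup_{\theta\in\Theta}\sup_{P_\theta\in\mathcal{P}_\theta}\inf\{r\in[0,\infty):P_\theta\{L(\hat\theta,\theta)\le r\}\ge1-\delta\},$$ where the first infimum is over all measurable functions $\hat\theta:\mathcal{X}\to\Theta$ (which may depend on $\delta$). Here $\mathcal{X}=(\mathbb{R}^d)^n$.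 The notation $\mathcal{M}(\delta,\mathcal{P}_\Theta,\|\cdot\|_\infty)$ refers to the loss $L(\theta,\theta')=\|\theta-\theta'\|_\infty$. $a\asymp b$ means that there are universal constants $c,C>0$ (not depending on any of the parameters, here $n,d,\sigma,\delta$) with $cb\le a\le Cb$. *)

theory Defs
  imports
    "HOL-Probability.Probability"
    "Jordan_Normal_Form.Determinant"
    "Jordan_Normal_Form.Gauss_Jordan_Elimination"
begin

text \<open>
  The dimension is quantified inside the statement (the constants must not depend on it), so
  \<open>\<real>\<^sup>d\<close> is the set of functions on \<open>{..<d}\<close>, extended by \<^const>\<open>undefined\<close>; the product
  \<open>\<sigma>\<close>-algebra on it is the Borel \<open>\<sigma>\<close>-algebra of the sup-norm.
\<close>

abbreviation Rd :: "nat \<Rightarrow> (nat \<Rightarrow> real) measure" where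
  "Rd d \<equiv> PiM {..<d} (\<lambda>_. borel)"

definition vec_sup_norm :: "nat \<Rightarrow> (nat \<Rightarrow> real) \<Rightarrow> real" where
  "vec_sup_norm d v = Max ((\<lambda>j. \<bar>v j\<bar>) ` {..<d})"

definition mat_max_norm :: "nat \<Rightarrow> real mat \<Rightarrow> real" where
  "mat_max_norm d S = Max ((\<lambda>(i, j). \<bar>S $$ (i, j)\<bar>) ` ({..<d} \<times> {..<d}))"

definition spd_mats :: "nat \<Rightarrow> real mat set" where
  "spd_mats d = {S \<in> carrier_mat d d. transpose_mat S = S \<and>
     (\<forall>v \<in> carrier_vec d. v \<noteq> 0\<^sub>v d \<longrightarrow> Matrix.scalar_prod v (S *\<^sub>v v) > 0)}"

definition mvn_density :: "nat \<Rightarrow> (nat \<Rightarrow> real) \<Rightarrow> real mat \<Rightarrow> (nat \<Rightarrow> real) \<Rightarrow> real" where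
  "mvn_density d \<theta> S x =
     (let y = Matrix.vec d (\<lambda>i. x i - \<theta> i)
      in exp (- Matrix.scalar_prod y (the (mat_inverse S) *\<^sub>v y) / 2)
           / sqrt ((2 * pi) ^ d * Determinant.det S))"

definition mvn :: "nat \<Rightarrow> (nat \<Rightarrow> real) \<Rightarrow> real mat \<Rightarrow> (nat \<Rightarrow> real) measure" where
  "mvn d \<theta> S = density (PiM {..<d} (\<lambda>_. lborel)) (\<lambda>x. ennreal (mvn_density d \<theta> S x))"

text \<open>The use of \<^const>\<open>the\<close> in \<^const>\<open>mvn_density\<close> is harmless for the matrices considered:\<close>

lemma spd_mats_inverse:
  assumes "S \<in> spd_mats d"
  obtains B where "mat_inverse S = Some B" "B \<in> carrier_mat d d" "S * B = 1\<^sub>m d" "B * S = 1\<^sub>m d"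
proof -
  have S: "S \<in> carrier_mat d d" using assms by (simp add: spd_mats_def)
  have "Determinant.det S \<noteq> 0"
  proof
    assume "Determinant.det S = 0"
    then obtain v where v: "v \<in> carrier_vec d" "v \<noteq> 0\<^sub>v d" "S *\<^sub>v v = 0\<^sub>v d"
      using det_0_iff_vec_prod_zero[OF S] by auto
    then have "Matrix.scalar_prod v (S *\<^sub>v v) = 0" by simp
    with v assms show False by (auto simp: spd_mats_def)
  qed
  then have "S \<in> Units (ring_mat TYPE(real) d ())"
    by (rule det_non_zero_imp_unit[OF S])
  then obtain B where "mat_inverse S = Some B"
    using mat_inverse(1)[OF S, where b = "()"] by (cases "mat_inverse S") auto
  then show thesis
    using mat_inverse(2)[OF S] that by blast
qed

text \<open>
  In the following general definition, \<open>T\<close> is the parameter space \<open>\<Theta>\<close> with its Borel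
  \<open>\<sigma>\<close>-algebra and \<open>X\<close> the sample space. Values are in \<^typ>\<open>ennreal\<close>, so that the infimum of
  the empty set and the supremum of an unbounded set are \<open>\<infinity>\<close>.
\<close>

definition loss_quantile ::
    "real \<Rightarrow> 'x measure \<Rightarrow> ('t \<Rightarrow> 't \<Rightarrow> real) \<Rightarrow> ('x \<Rightarrow> 't) \<Rightarrow> 't \<Rightarrow> ennreal" where
  "loss_quantile \<delta> P L est \<theta> =
     (INF r \<in> {r. 0 \<le> r \<and> measure P {x \<in> space P. L (est x) \<theta> \<le> r} \<ge> 1 - \<delta>}. ennreal r)"

definition minimax_quantile ::
    "real \<Rightarrow> 'x measure \<Rightarrow> 't measure \<Rightarrow> ('t \<Rightarrow> 'x measure set) \<Rightarrow> ('t \<Rightarrow> 't \<Rightarrow> real) \<Rightarrow> ennreal" where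
  "minimax_quantile \<delta> X T \<P> L =
     (INF est \<in> measurable X T. SUP \<theta> \<in> space T. SUP P \<in> \<P> \<theta>. loss_quantile \<delta> P L est \<theta>)"

definition gaussian_family ::
    "nat \<Rightarrow> nat \<Rightarrow> real \<Rightarrow> (nat \<Rightarrow> real) \<Rightarrow> (nat \<Rightarrow> nat \<Rightarrow> real) measure set" where
  "gaussian_family n d \<sigma> \<theta> =
     {PiM {..<n} (\<lambda>_. mvn d \<theta> S) |S. S \<in> spd_mats d \<and> mat_max_norm d S \<le> \<sigma>\<^sup>2}"

end

theory Submission
  imports Defs
begin

text \<open>
  Completing the square gives the tilting identity
  \<open>N(\<theta> + l \<cdot> S e\<^sub>j, S) = exp (l (x\<^sub>j - \<theta>\<^sub>j) - l\<^sup>2 S\<^sub>j\<^sub>j / 2) \<cdot> N(\<theta>, S)\<close>, from which everything follows.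
  Its total mass gives the moment generating function of a coordinate, hence a Chernoff bound for
  each coordinate of the sample mean, and a union bound over the coordinates gives the upper bound.

  For the lower bound take \<open>S = \<sigma>\<^sup>2 I\<close> and the \<open>d + 1\<close> parameters \<open>0\<close> and \<open>t e\<^sub>j\<close> with \<open>t\<close> twice the
  claimed lower bound on the quantile. The events that the estimator is close to these are disjoint, so under \<open>0\<close>
  those of the \<open>t e\<^sub>j\<close> have total probability at most \<open>\<delta>\<close>, and some \<open>j\<close> has probability at most
  \<open>\<delta> / d\<close>. Under \<open>t e\<^sub>j\<close> the same event has probability at least \<open>3 / 4\<close>, which the second moment
  \<open>exp (n t\<^sup>2 / \<sigma>\<^sup>2)\<close> of the likelihood ratio excludes unless \<open>t\<close> is of order
  \<open>\<sigma> sqrt (ln (d / \<delta>) / n)\<close>.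
\<close>

subsection \<open>Positive definite quadratic forms and the Gaussian integral\<close>

text \<open>Coordinates are plain functions, as in \<open>PiM\<close>, so that the last one can be
  split off or replaced by a function update; only indices below \<open>d\<close> matter.\<close>

definition quad_form :: "nat \<Rightarrow> real mat \<Rightarrow> (nat \<Rightarrow> real) \<Rightarrow> real" where
  "quad_form d A y = (\<Sum>i<d. \<Sum>k<d. A $$ (i, k) * y i * y k)"

lemma scalar_prod_vec_eq_quad_form:
  assumes "A \<in> carrier_mat d d"
  shows "Matrix.scalar_prod (Matrix.vec d y) (A *\<^sub>v Matrix.vec d y) = quad_form d A y"
  using assms unfolding quad_form_def
  by (auto simp: scalar_prod_def lessThan_atLeast0 sum_distrib_left mult_ac intro!: sum.cong)

text \<open>The working form of positive definiteness: it carries the induction on the dimension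
  without vectors of a fixed length.\<close>

lemma spd_mats_iff:
  "A \<in> spd_mats d \<longleftrightarrow> A \<in> carrier_mat d d \<and> (\<forall>i<d. \<forall>k<d. A $$ (i, k) = A $$ (k, i)) \<and>
     (\<forall>y. (\<exists>i<d. y i \<noteq> 0) \<longrightarrow> quad_form d A y > 0)"
proof (cases "A \<in> carrier_mat d d")
  case True
  have sym: "transpose_mat A = A \<longleftrightarrow> (\<forall>i<d. \<forall>k<d. A $$ (i, k) = A $$ (k, i))"
    using True by (auto simp: mat_eq_iff)
  have "(\<forall>v \<in> carrier_vec d. v \<noteq> 0\<^sub>v d \<longrightarrow> Matrix.scalar_prod v (A *\<^sub>v v) > 0) \<longleftrightarrow>
      (\<forall>y. (\<exists>i<d. y i \<noteq> 0) \<longrightarrow> quad_form d A y > 0)" (is "?L \<longleftrightarrow> ?R")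
  proof
    assume L: ?L
    show ?R
    proof (intro allI impI)
      fix y :: "nat \<Rightarrow> real" assume "\<exists>i<d. y i \<noteq> 0"
      then have "Matrix.vec d y \<noteq> 0\<^sub>v d" by (auto simp: vec_eq_iff)
      then show "quad_form d A y > 0"
        using L scalar_prod_vec_eq_quad_form[OF True, of y] by auto
    qed
  next
    assume R: ?R
    show ?L
    proof (intro ballI impI)
      fix v :: "real Matrix.vec" assume v: "v \<in> carrier_vec d" "v \<noteq> 0\<^sub>v d"
      have eq: "v = Matrix.vec d (\<lambda>i. vec_index v i)" using v by auto
      have "\<exists>i<d. vec_index v i \<noteq> 0" using v by auto
      then show "Matrix.scalar_prod v (A *\<^sub>v v) > 0"
        using R scalar_prod_vec_eq_quad_form[OF True, of "vec_index v"] eq by metis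
    qed
  qed
  then show ?thesis using True sym by (simp add: spd_mats_def)
qed (simp add: spd_mats_def)

text \<open>The complement of the last diagonal entry, for \<open>A\<close> of size
  \<open>Suc d\<close>. By symmetry of \<open>A\<close> the last row is written as the last column,
  which makes symmetry of the result immediate.\<close>

definition schur_complement :: "nat \<Rightarrow> real mat \<Rightarrow> real mat" where
  "schur_complement d A =
     Matrix.mat d d (\<lambda>(i, k). A $$ (i, k) - A $$ (i, d) * A $$ (k, d) / A $$ (d, d))"

lemma spd_mats_diag_pos:
  assumes "A \<in> spd_mats d" "i < d"
  shows "A $$ (i, i) > 0"
proof -
  have "quad_form d A (\<lambda>k. if k = i then 1 else 0) > 0"
    using assms unfolding spd_mats_iff by auto
  also have "quad_form d A (\<lambda>k. if k = i then 1 else 0) = A $$ (i, i)"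
    using assms(2) by (simp add: quad_form_def if_distrib[of "\<lambda>x. _ * x"] cong: if_cong)
  finally show ?thesis .
qed

text \<open>Completing the square in the last coordinate: the pivot \<open>A $$ (d, d)\<close> is
  positive, and what the square leaves over is the form of the Schur complement.\<close>

lemma quad_form_Suc:
  assumes "A \<in> spd_mats (Suc d)"
  shows "quad_form (Suc d) A y =
    A $$ (d, d) * (y d + (\<Sum>i<d. A $$ (i, d) * y i) / A $$ (d, d))\<^sup>2
      + quad_form d (schur_complement d A) y"
proof -
  let ?c = "A $$ (d, d)" and ?s = "\<Sum>i<d. A $$ (i, d) * y i"
  have c: "?c > 0" using spd_mats_diag_pos[OF assms] by simp
  have sym: "A $$ (d, k) = A $$ (k, d)" if "k < d" for k
    using assms that unfolding spd_mats_iff by auto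
  have row: "(\<Sum>k<d. A $$ (d, k) * y d * y k) = y d * ?s"
    by (simp add: sum_distrib_left sym mult_ac)
  have col: "(\<Sum>i<d. A $$ (i, d) * y i * y d) = y d * ?s"
    by (simp add: sum_distrib_left mult_ac)
  have "?s\<^sup>2 / ?c = (\<Sum>i<d. \<Sum>k<d. A $$ (i, d) * A $$ (k, d) / ?c * y i * y k)"
    by (simp add: power2_eq_square sum_product sum_divide_distrib mult_ac)
  then have schur: "quad_form d (schur_complement d A) y = quad_form d A y - ?s\<^sup>2 / ?c"
    by (simp add: quad_form_def schur_complement_def left_diff_distrib sum_subtractf)
  have "quad_form (Suc d) A y = quad_form d A y + 2 * y d * ?s + ?c * y d * y d"
    using row col by (simp add: quad_form_def sum.distrib)
  also have "\<dots> = ?c * (y d + ?s / ?c)\<^sup>2 + quad_form d (schur_complement d A) y"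
    unfolding schur using c by (simp add: field_simps power2_eq_square)
  finally show ?thesis .
qed

lemma quad_form_cong: "(\<And>i. i < d \<Longrightarrow> y i = z i) \<Longrightarrow> quad_form d A y = quad_form d A z"
  by (simp add: quad_form_def)

lemma schur_complement_spd:
  assumes "A \<in> spd_mats (Suc d)"
  shows "schur_complement d A \<in> spd_mats d"
proof -
  let ?c = "A $$ (d, d)"
  have c: "?c > 0" using spd_mats_diag_pos[OF assms] by simp
  have "quad_form d (schur_complement d A) y > 0" if "\<exists>i<d. y i \<noteq> 0" for y
  proof -
    \<comment> \<open>This value of the last coordinate minimises the full form for fixed
      \<open>y\<close>: the square in \<open>quad_form_Suc\<close> vanishes there.\<close>
    define z where "z = y(d := - (\<Sum>i<d. A $$ (i, d) * y i) / ?c)"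
    from that obtain i where "i < d" "y i \<noteq> 0" by blast
    then have "i < Suc d" "z i \<noteq> 0" by (auto simp: z_def)
    then have "quad_form (Suc d) A z > 0"
      using assms unfolding spd_mats_iff by blast
    moreover have "(\<Sum>i<d. A $$ (i, d) * z i) = (\<Sum>i<d. A $$ (i, d) * y i)"
      by (simp add: z_def)
    then have "z d + (\<Sum>i<d. A $$ (i, d) * z i) / ?c = 0" by (simp add: z_def)
    ultimately have "quad_form d (schur_complement d A) z > 0"
      using quad_form_Suc[OF assms, of z] by simp
    moreover have "quad_form d (schur_complement d A) z = quad_form d (schur_complement d A) y"
      by (rule quad_form_cong) (simp add: z_def)
    ultimately show ?thesis by simp
  qed
  moreover have "schur_complement d A \<in> carrier_mat d d"
    by (simp add: schur_complement_def)
  moreover have "schur_complement d A $$ (i, k) = schur_complement d A $$ (k, i)"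
    if "i < d" "k < d" for i k
  proof -
    have "A $$ (i, k) = A $$ (k, i)"
      using assms that unfolding spd_mats_iff by simp
    then show ?thesis using that by (simp add: schur_complement_def)
  qed
  ultimately show ?thesis
    unfolding spd_mats_iff by blast
qed

text \<open>One step of block elimination: \<open>A\<close> is the product of an upper and a lower
  block triangular matrix, whose determinants are read off their diagonal blocks.\<close>

lemma det_schur_complement:
  assumes "A \<in> spd_mats (Suc d)"
  shows "Determinant.det A = A $$ (d, d) * Determinant.det (schur_complement d A)"
proof -
  let ?c = "A $$ (d, d)"
  have A: "A \<in> carrier_mat (Suc d) (Suc d)" and c: "?c > 0"
    and sym: "\<And>k. k < d \<Longrightarrow> A $$ (d, k) = A $$ (k, d)"
    using assms spd_mats_diag_pos[OF assms, of d] unfolding spd_mats_iff by auto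
  define S where "S = schur_complement d A"
  define b where "b = Matrix.mat d 1 (\<lambda>(i, _). A $$ (i, d))"
  define r where "r = Matrix.mat 1 d (\<lambda>(_, k). A $$ (k, d) / ?c)"
  define C where "C = Matrix.mat 1 1 (\<lambda>_. ?c)"
  have cs: "S \<in> carrier_mat d d" "b \<in> carrier_mat d 1" "r \<in> carrier_mat 1 d" "C \<in> carrier_mat 1 1"
    by (auto simp: S_def schur_complement_def b_def r_def C_def)
  \<comment> \<open>The blocks stay unsimplified so that they match the multiplication rule for
    block matrices.\<close>
  have "A = four_block_mat (S * 1\<^sub>m d + b * r) (S * 0\<^sub>m d 1 + b * 1\<^sub>m 1)
      (0\<^sub>m 1 d * 1\<^sub>m d + C * r) (0\<^sub>m 1 d * 0\<^sub>m d 1 + C * 1\<^sub>m 1)"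
  proof (rule eq_matI)
    show "dim_row A = dim_row (four_block_mat (S * 1\<^sub>m d + b * r) (S * 0\<^sub>m d 1 + b * 1\<^sub>m 1)
      (0\<^sub>m 1 d * 1\<^sub>m d + C * r) (0\<^sub>m 1 d * 0\<^sub>m d 1 + C * 1\<^sub>m 1))"
      using A cs by simp
    show "dim_col A = dim_col (four_block_mat (S * 1\<^sub>m d + b * r) (S * 0\<^sub>m d 1 + b * 1\<^sub>m 1)
      (0\<^sub>m 1 d * 1\<^sub>m d + C * r) (0\<^sub>m 1 d * 0\<^sub>m d 1 + C * 1\<^sub>m 1))"
      using A cs by simp
    fix i j assume "i < dim_row (four_block_mat (S * 1\<^sub>m d + b * r) (S * 0\<^sub>m d 1 + b * 1\<^sub>m 1)
      (0\<^sub>m 1 d * 1\<^sub>m d + C * r) (0\<^sub>m 1 d * 0\<^sub>m d 1 + C * 1\<^sub>m 1))"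
      "j < dim_col (four_block_mat (S * 1\<^sub>m d + b * r) (S * 0\<^sub>m d 1 + b * 1\<^sub>m 1)
      (0\<^sub>m 1 d * 1\<^sub>m d + C * r) (0\<^sub>m 1 d * 0\<^sub>m d 1 + C * 1\<^sub>m 1))"
    then have "i < Suc d" "j < Suc d" using cs by auto
    then show "A $$ (i, j) = four_block_mat (S * 1\<^sub>m d + b * r) (S * 0\<^sub>m d 1 + b * 1\<^sub>m 1)
      (0\<^sub>m 1 d * 1\<^sub>m d + C * r) (0\<^sub>m 1 d * 0\<^sub>m d 1 + C * 1\<^sub>m 1) $$ (i, j)"
      using cs c sym
      by (auto simp: less_Suc_eq S_def schur_complement_def b_def r_def C_def scalar_prod_def)
  qed
  also have "\<dots> = four_block_mat S b (0\<^sub>m 1 d) C * four_block_mat (1\<^sub>m d) (0\<^sub>m d 1) r (1\<^sub>m 1)"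
    using cs by (intro mult_four_block_mat[symmetric]) auto
  finally have "Determinant.det A = Determinant.det (four_block_mat S b (0\<^sub>m 1 d) C)
      * Determinant.det (four_block_mat (1\<^sub>m d) (0\<^sub>m d 1) r (1\<^sub>m 1))"
    using cs by (metis det_mult four_block_carrier_mat one_carrier_mat)
  also have "Determinant.det (four_block_mat S b (0\<^sub>m 1 d) C) = Determinant.det S * Determinant.det C"
    using cs by (intro det_four_block_mat_lower_left_zero) auto
  also have "Determinant.det (four_block_mat (1\<^sub>m d) (0\<^sub>m d 1) r (1\<^sub>m 1))
      = Determinant.det (1\<^sub>m d :: real mat) * Determinant.det (1\<^sub>m 1 :: real mat)"
    using cs(3) by (intro det_four_block_mat_upper_right_zero) auto
  also have "Determinant.det C = ?c" by (simp add: C_def det_single)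
  finally show ?thesis by (simp add: S_def)
qed

lemma det_spd_pos: "A \<in> spd_mats d \<Longrightarrow> Determinant.det A > 0"
proof (induction d arbitrary: A)
  case 0
  then show ?case by (simp add: spd_mats_def)
next
  case (Suc d)
  then show ?case
    using det_schur_complement[OF Suc.prems] schur_complement_spd[OF Suc.prems]
      spd_mats_diag_pos[OF Suc.prems, of d] by simp
qed

text \<open>The integrand is a multiple of the normal density with standard deviation
  \<open>1 / sqrt c\<close>, whose total mass is 1.\<close>

lemma nn_integral_exp_neg_square:
  fixes c m :: real
  assumes "c > 0"
  shows "(\<integral>\<^sup>+s. ennreal (exp (- (c * (s - m)\<^sup>2 / 2))) \<partial>lborel) = ennreal (sqrt (2 * pi / c))"
proof -
  have eq: "exp (- (c * (s - m)\<^sup>2 / 2)) = sqrt (2 * pi / c) * normal_density m (1 / sqrt c) s" for s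
  proof -
    have sq: "(1 / sqrt c)\<^sup>2 = 1 / c"
      using assms by (simp add: power_divide)
    have "sqrt (2 * pi / c) \<noteq> 0" using assms by simp
    then have "sqrt (2 * pi / c) * (1 / sqrt (2 * pi * (1 / sqrt c)\<^sup>2)) = 1"
      unfolding sq by simp
    moreover have "- (s - m)\<^sup>2 / (2 * (1 / sqrt c)\<^sup>2) = - (c * (s - m)\<^sup>2 / 2)"
      unfolding sq by simp
    ultimately show ?thesis by (simp only: normal_density_def mult.assoc[symmetric] mult_1_left)
  qed
  have "(\<integral>\<^sup>+s. ennreal (normal_density m (1 / sqrt c) s) \<partial>lborel) = 1"
    using prob_space.emeasure_space_1[OF prob_space_normal_density[of "1 / sqrt c" m]] assms
    by (simp add: emeasure_density)
  then show ?thesis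
    unfolding eq using assms by (simp add: ennreal_mult nn_integral_cmult)
qed

section \<open>The Gaussian integral in dimension d\<close>

interpretation lborel_product: product_sigma_finite "\<lambda>_::nat. lborel :: real measure"
  by standard

lemma quad_form_measurable [measurable]:
  "(\<lambda>x. quad_form d A (\<lambda>i. x i - m i)) \<in> borel_measurable (PiM {..<d} (\<lambda>_. lborel))"
  unfolding quad_form_def by measurable

text \<open>Induction on the dimension by Tonelli: integrating out the last coordinate yields a
  one-dimensional Gaussian integral with the pivot as precision and leaves the Schur complement; the
  determinant splits in the same way.\<close>

lemma nn_integral_gaussian:
  assumes "A \<in> spd_mats d"
  shows "(\<integral>\<^sup>+x. ennreal (exp (- (quad_form d A (\<lambda>i. x i - m i) / 2))) \<partial>PiM {..<d} (\<lambda>_. lborel))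
    = ennreal (sqrt ((2 * pi) ^ d / Determinant.det A))"
  using assms
proof (induction d arbitrary: A)
  case 0
  then show ?case
    by (simp add: space_PiM_empty quad_form_def spd_mats_def)
next
  case (Suc d)
  let ?c = "A $$ (d, d)" and ?S = "schur_complement d A"
  let ?f = "\<lambda>x. ennreal (exp (- (quad_form (Suc d) A (\<lambda>i. x i - m i) / 2)))"
  have c: "?c > 0" using spd_mats_diag_pos[OF Suc.prems] by simp
  note S = schur_complement_spd[OF Suc.prems]
  have meas: "?f \<in> borel_measurable (PiM {..<Suc d} (\<lambda>_. lborel))" by measurable
  have inner: "(\<integral>\<^sup>+s. ?f (x(d := s)) \<partial>lborel) =
      ennreal (sqrt (2 * pi / ?c)) * ennreal (exp (- (quad_form d ?S (\<lambda>i. x i - m i) / 2)))" for x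
  proof -
    \<comment> \<open>With \<open>A\<close> as precision matrix, \<open>t\<close> is the conditional
      mean of the last coordinate given the others.\<close>
    define t where "t = m d - (\<Sum>i<d. A $$ (i, d) * (x i - m i)) / ?c"
    have "quad_form (Suc d) A (\<lambda>i. (x(d := s)) i - m i) =
        ?c * (s - t)\<^sup>2 + quad_form d ?S (\<lambda>i. x i - m i)" for s
      unfolding quad_form_Suc[OF Suc.prems]
      by (simp add: t_def quad_form_def algebra_simps)
    then have "?f (x(d := s)) = ennreal (exp (- (?c * (s - t)\<^sup>2 / 2)))
        * ennreal (exp (- (quad_form d ?S (\<lambda>i. x i - m i) / 2)))" for s
      by (simp add: ennreal_mult[symmetric] exp_add[symmetric] add_divide_distrib diff_divide_distrib)
    then show ?thesis
      using c by (simp add: nn_integral_multc nn_integral_exp_neg_square)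
  qed
  have "(\<integral>\<^sup>+x. ?f x \<partial>PiM {..<Suc d} (\<lambda>_. lborel))
      = (\<integral>\<^sup>+x. (\<integral>\<^sup>+s. ?f (x(d := s)) \<partial>lborel) \<partial>PiM {..<d} (\<lambda>_. lborel))"
    unfolding lessThan_Suc
    by (rule lborel_product.product_nn_integral_insert) (use meas in \<open>simp_all add: lessThan_Suc\<close>)
  also have "\<dots> = ennreal (sqrt (2 * pi / ?c)) * ennreal (sqrt ((2 * pi) ^ d / Determinant.det ?S))"
    unfolding inner by (subst nn_integral_cmult) (simp_all add: Suc.IH[OF S])
  also have "\<dots> = ennreal (sqrt ((2 * pi) ^ Suc d / Determinant.det A))"
    using c det_spd_pos[OF S]
    by (simp add: det_schur_complement[OF Suc.prems] ennreal_mult[symmetric] real_sqrt_mult[symmetric])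
  finally show ?case .
qed

subsection \<open>Tilting a normal distribution\<close>

lemma spd_mats_inverse_spd:
  assumes "S \<in> spd_mats d"
  obtains B where "mat_inverse S = Some B" "B \<in> spd_mats d" "B * S = 1\<^sub>m d"
    "Determinant.det S * Determinant.det B = 1"
proof -
  obtain B where B: "mat_inverse S = Some B" "B \<in> carrier_mat d d" "S * B = 1\<^sub>m d" "B * S = 1\<^sub>m d"
    using spd_mats_inverse[OF assms] .
  have S: "S \<in> carrier_mat d d" "transpose_mat S = S" using assms by (auto simp: spd_mats_def)
  \<comment> \<open>The transpose of \<open>B\<close> is also a left inverse of \<open>S\<close>, so
    it equals \<open>B\<close>.\<close>
  have "transpose_mat B * S = transpose_mat (S * B)"
    by (subst transpose_mult[OF S(1) B(2)]) (simp add: S)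
  then have BS: "transpose_mat B * S = 1\<^sub>m d" unfolding B(3) by simp
  have "transpose_mat B = transpose_mat B * (S * B)" using B by simp
  also have "\<dots> = (transpose_mat B * S) * B"
    by (rule assoc_mult_mat[symmetric]) (use B S in auto)
  finally have sym: "transpose_mat B = B" using BS B by simp
  have "Matrix.scalar_prod v (B *\<^sub>v v) > 0" if v: "v \<in> carrier_vec d" "v \<noteq> 0\<^sub>v d" for v
  proof -
    \<comment> \<open>Substituting \<open>v = S w\<close> turns the form of \<open>B\<close> at
      \<open>v\<close> into the form of \<open>S\<close> at \<open>w\<close>.\<close>
    define w where "w = B *\<^sub>v v"
    have w: "w \<in> carrier_vec d" using B v by (simp add: w_def)
    have Sw: "S *\<^sub>v w = v"
      unfolding w_def using B S v by (simp add: assoc_mult_mat_vec[symmetric, of S d d B d])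
    have "w \<noteq> 0\<^sub>v d"
    proof
      assume "w = 0\<^sub>v d"
      moreover have "S *\<^sub>v 0\<^sub>v d = 0\<^sub>v d" using S by (intro eq_vecI) auto
      ultimately show False using Sw v by simp
    qed
    then have "Matrix.scalar_prod w (S *\<^sub>v w) > 0"
      using assms w by (auto simp: spd_mats_def)
    then show ?thesis
      unfolding Sw using comm_scalar_prod[OF w v(1)] by (simp add: w_def)
  qed
  then have "B \<in> spd_mats d" using B sym by (auto simp: spd_mats_def)
  moreover have "Determinant.det S * Determinant.det B = 1"
    using det_mult[OF S(1) B(2)] B(3) by simp
  ultimately show thesis using B that by blast
qed

section \<open>Density and total mass of the normal distribution\<close>

lemma mvn_density_eq:
  assumes "mat_inverse S = Some B" "B \<in> carrier_mat d d"
  shows "mvn_density d \<theta> S x =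
    exp (- (quad_form d B (\<lambda>i. x i - \<theta> i) / 2)) / sqrt ((2 * pi) ^ d * Determinant.det S)"
  using assms scalar_prod_vec_eq_quad_form[OF assms(2), of "\<lambda>i. x i - \<theta> i"]
  by (simp add: mvn_density_def)

lemma mvn_density_nonneg: "S \<in> spd_mats d \<Longrightarrow> 0 \<le> mvn_density d \<theta> S x"
  using det_spd_pos[of S d] by (simp add: mvn_density_def Let_def)

lemma mvn_density_measurable:
  assumes "S \<in> spd_mats d"
  shows "mvn_density d \<theta> S \<in> borel_measurable (PiM {..<d} (\<lambda>_. lborel))"
proof -
  obtain B where B: "mat_inverse S = Some B" "B \<in> spd_mats d"
    using spd_mats_inverse_spd[OF assms] by blast
  then have "B \<in> carrier_mat d d" by (simp add: spd_mats_def)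
  from mvn_density_eq[OF B(1) this] show ?thesis
    by (simp add: fun_eq_iff[symmetric] cong: measurable_cong)
qed

lemma sets_mvn [simp, measurable_cong]: "sets (mvn d \<theta> S) = sets (Rd d)"
  by (simp add: mvn_def cong: sets_PiM_cong)

lemma space_mvn [simp]: "space (mvn d \<theta> S) = space (Rd d)"
  by (rule sets_eq_imp_space_eq) simp

text \<open>Tilted means are functions on all naturals, while elements of \<open>Rd d\<close> are
  \<open>undefined\<close> from \<open>d\<close> on; this identifies the two.\<close>

lemma mvn_cong:
  assumes "\<And>i. i < d \<Longrightarrow> \<theta> i = \<theta>' i"
  shows "mvn d \<theta> S = mvn d \<theta>' S"
proof -
  have "Matrix.vec d (\<lambda>i. x i - \<theta> i) = Matrix.vec d (\<lambda>i. x i - \<theta>' i)" for x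
    using assms by (intro eq_vecI) auto
  then show ?thesis by (simp add: mvn_def mvn_density_def)
qed

lemma prob_space_mvn:
  assumes "S \<in> spd_mats d"
  shows "prob_space (mvn d \<theta> S)"
proof
  obtain B where B: "mat_inverse S = Some B" "B \<in> spd_mats d"
      and det: "Determinant.det S * Determinant.det B = 1"
    using spd_mats_inverse_spd[OF assms] by blast
  then have Bc: "B \<in> carrier_mat d d" by (simp add: spd_mats_def)
  define z where "z = (2 * pi) ^ d * Determinant.det S"
  have z: "z > 0" using det_spd_pos[OF assms] by (simp add: z_def)
  \<comment> \<open>The density is normalised by the determinant of \<open>S\<close>, whereas the
    Gaussian integral produces that of the precision matrix \<open>B\<close>.\<close>
  have zB: "(2 * pi) ^ d / Determinant.det B = z"
    using det det_spd_pos[OF B(2)] by (simp add: z_def field_simps)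
  have "emeasure (mvn d \<theta> S) (space (mvn d \<theta> S)) =
      (\<integral>\<^sup>+x. ennreal (mvn_density d \<theta> S x) \<partial>PiM {..<d} (\<lambda>_. lborel))"
    using mvn_density_measurable[OF assms]
    by (subst space_mvn, simp add: mvn_def emeasure_density space_PiM cong: nn_integral_cong)
       (auto intro!: nn_integral_cong simp: space_PiM indicator_def)
  also have "\<dots> = (\<integral>\<^sup>+x. ennreal (exp (- (quad_form d B (\<lambda>i. x i - \<theta> i) / 2))) * ennreal (1 / sqrt z)
      \<partial>PiM {..<d} (\<lambda>_. lborel))"
    using z by (simp add: mvn_density_eq[OF B(1) Bc] z_def ennreal_mult[symmetric])
  also have "\<dots> = ennreal (sqrt z) * ennreal (1 / sqrt z)"
    by (subst nn_integral_multc) (simp_all only: nn_integral_gaussian[OF B(2)] zB, measurable)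
  also have "\<dots> = 1" using z by (simp add: ennreal_mult[symmetric])
  finally show "emeasure (mvn d \<theta> S) (space (mvn d \<theta> S)) = 1" .
qed

text \<open>The shift is a multiple of column \<open>j\<close> of \<open>S\<close>, which
  \<open>B\<close> maps to a unit vector. Hence the cross term sees only coordinate
  \<open>j\<close>, and the inverse drops out of the ratio of the densities.\<close>

lemma mvn_density_tilt:
  assumes S: "S \<in> spd_mats d" and j: "j < d"
  shows "mvn_density d (\<lambda>i. \<theta> i + l * S $$ (i, j)) S x =
    mvn_density d \<theta> S x * exp (l * (x j - \<theta> j) - l\<^sup>2 * S $$ (j, j) / 2)"
proof -
  obtain B where B: "mat_inverse S = Some B" "B \<in> spd_mats d" "B * S = 1\<^sub>m d"
    using spd_mats_inverse_spd[OF S] by blast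
  then have Bc: "B \<in> carrier_mat d d" by (simp add: spd_mats_def)
  have Sc: "S \<in> carrier_mat d d" using S by (simp add: spd_mats_def)
  define y where "y i = x i - \<theta> i" for i
  define s where "s i = S $$ (i, j)" for i
  have Bs: "(\<Sum>k<d. B $$ (i, k) * s k) = (if i = j then 1 else 0)" if "i < d" for i
  proof -
    have "(B * S) $$ (i, j) = (\<Sum>k<d. B $$ (i, k) * s k)"
      using that j Bc Sc by (simp add: scalar_prod_def s_def lessThan_atLeast0)
    then show ?thesis using that j B(3) by simp
  qed
  have polar: "(\<Sum>i<d. \<Sum>k<d. B $$ (i, k) * u i * s k) = u j" for u
  proof -
    have "(\<Sum>i<d. \<Sum>k<d. B $$ (i, k) * u i * s k) = (\<Sum>i<d. u i * (\<Sum>k<d. B $$ (i, k) * s k))"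
      by (simp add: sum_distrib_left mult_ac)
    also have "\<dots> = (\<Sum>i<d. u i * (if i = j then 1 else 0))" by (simp add: Bs)
    finally show ?thesis using j by (simp add: if_distrib[of "\<lambda>x. _ * x"] cong: if_cong)
  qed
  \<comment> \<open>The same pairing with its arguments exchanged, by symmetry of
    \<open>B\<close>.\<close>
  have polar': "(\<Sum>i<d. \<Sum>k<d. B $$ (i, k) * s i * u k) = u j" for u
  proof -
    have "(\<Sum>i<d. \<Sum>k<d. B $$ (i, k) * s i * u k) = (\<Sum>k<d. \<Sum>i<d. B $$ (k, i) * u k * s i)"
      by (subst sum.swap) (use B(2) in \<open>auto simp: spd_mats_iff mult_ac intro!: sum.cong\<close>)
    then show ?thesis by (simp add: polar)
  qed
  have "quad_form d B (\<lambda>i. y i - l * s i) = quad_form d B y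
      - l * (\<Sum>i<d. \<Sum>k<d. B $$ (i, k) * y i * s k)
      - l * (\<Sum>i<d. \<Sum>k<d. B $$ (i, k) * s i * y k)
      + l\<^sup>2 * (\<Sum>i<d. \<Sum>k<d. B $$ (i, k) * s i * s k)"
    unfolding quad_form_def sum_distrib_left sum_subtractf[symmetric] sum.distrib[symmetric]
    by (intro sum.cong refl) (simp add: algebra_simps power2_eq_square)
  then have "quad_form d B (\<lambda>i. y i - l * s i) = quad_form d B y - 2 * l * y j + l\<^sup>2 * s j"
    by (simp add: polar polar')
  moreover have "(\<lambda>i. y i - l * s i) = (\<lambda>i. x i - (\<theta> i + l * S $$ (i, j)))"
    "y = (\<lambda>i. x i - \<theta> i)"
    by (auto simp: y_def s_def)
  ultimately have "- (quad_form d B (\<lambda>i. x i - (\<theta> i + l * S $$ (i, j))) / 2) =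
      - (quad_form d B (\<lambda>i. x i - \<theta> i) / 2) + (l * (x j - \<theta> j) - l\<^sup>2 * S $$ (j, j) / 2)"
    by (simp add: s_def field_simps)
  then show ?thesis
    unfolding mvn_density_eq[OF B(1) Bc] by (simp only: exp_add times_divide_eq_left)
qed

lemma mvn_tilt:
  assumes S: "S \<in> spd_mats d" and j: "j < d"
  shows "mvn d (\<lambda>i. \<theta> i + l * S $$ (i, j)) S =
    density (mvn d \<theta> S) (\<lambda>x. ennreal (exp (l * (x j - \<theta> j) - l\<^sup>2 * S $$ (j, j) / 2)))"
proof -
  have [measurable]: "mvn_density d \<theta> S \<in> borel_measurable (PiM {..<d} (\<lambda>_. lborel))"
    by (rule mvn_density_measurable[OF S])
  have [measurable]: "(\<lambda>x. x j) \<in> borel_measurable (PiM {..<d} (\<lambda>_. lborel))"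
    using j measurable_component_singleton[of j "{..<d}" "\<lambda>_. lborel"] by simp
  show ?thesis
    unfolding mvn_def mvn_density_tilt[OF S j]
    by (subst density_density_eq) (simp_all add: ennreal_mult' mvn_density_nonneg[OF S])
qed

lemma mvn_component_measurable [measurable]:
  "j < d \<Longrightarrow> (\<lambda>x. x j) \<in> borel_measurable (mvn d \<theta> S)"
  using measurable_component_singleton[of j "{..<d}" "\<lambda>_. borel"]
  by (simp cong: measurable_cong_sets)

text \<open>No integral is computed: the tilted measure is again normal, so its density has integral
  1, and the constant factor moves to the other side.\<close>

lemma mvn_mgf:
  assumes S: "S \<in> spd_mats d" and j: "j < d"
  shows "(\<integral>\<^sup>+x. ennreal (exp (l * (x j - \<theta> j))) \<partial>mvn d \<theta> S) = ennreal (exp (l\<^sup>2 * S $$ (j, j) / 2))"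
proof -
  note [measurable] = mvn_component_measurable[OF j]
  let ?v = "l\<^sup>2 * S $$ (j, j) / 2"
  let ?g = "\<lambda>x. ennreal (exp (l * (x j - \<theta> j) - ?v))"
  have "1 = emeasure (density (mvn d \<theta> S) ?g) (space (mvn d \<theta> S))"
    using prob_space.emeasure_space_1[OF prob_space_mvn[OF S]]
    unfolding mvn_tilt[OF S j, symmetric] by (metis space_mvn)
  also have "\<dots> = (\<integral>\<^sup>+x. ?g x \<partial>mvn d \<theta> S)"
    by (subst emeasure_density) (auto intro!: nn_integral_cong)
  finally have one: "(\<integral>\<^sup>+x. ?g x \<partial>mvn d \<theta> S) = 1" ..
  have "(\<integral>\<^sup>+x. ennreal (exp (l * (x j - \<theta> j))) \<partial>mvn d \<theta> S)
      = (\<integral>\<^sup>+x. ennreal (exp ?v) * ?g x \<partial>mvn d \<theta> S)"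
    by (simp add: ennreal_mult[symmetric] exp_add[symmetric])
  also have "\<dots> = ennreal (exp ?v)"
    by (subst nn_integral_cmult) (simp_all add: one)
  finally show ?thesis .
qed

text \<open>A product measure is determined by its values on boxes; there the integrand is a product
  of functions of single coordinates and Tonelli factors the integral.\<close>

lemma density_PiM:
  assumes I: "finite I"
    and M: "\<And>i. prob_space (M i)" and D: "\<And>i. prob_space (density (M i) (f i))"
    and f [measurable]: "\<And>i. f i \<in> borel_measurable (M i)"
  shows "density (PiM I M) (\<lambda>x. \<Prod>i\<in>I. f i (x i)) = PiM I (\<lambda>i. density (M i) (f i))"
proof -
  interpret M: product_sigma_finite M
    using M by (simp add: product_sigma_finite_def prob_space_imp_sigma_finite)
  interpret D: product_sigma_finite "\<lambda>i. density (M i) (f i)"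
    using D by (simp add: product_sigma_finite_def prob_space_imp_sigma_finite)
  show ?thesis
  proof (rule D.PiM_eqI[OF I])
    show "sets (density (PiM I M) (\<lambda>x. \<Prod>i\<in>I. f i (x i))) = sets (PiM I (\<lambda>i. density (M i) (f i)))"
      by (simp cong: sets_PiM_cong)
    fix A assume "\<And>i. i \<in> I \<Longrightarrow> A i \<in> sets (density (M i) (f i))"
    then have A [measurable]: "A i \<in> sets (M i)" if "i \<in> I" for i using that by simp
    have "emeasure (density (PiM I M) (\<lambda>x. \<Prod>i\<in>I. f i (x i))) (Pi\<^sub>E I A) =
        (\<integral>\<^sup>+x. (\<Prod>i\<in>I. f i (x i)) * indicator (Pi\<^sub>E I A) x \<partial>PiM I M)"
      using I A by (subst emeasure_density) (auto intro!: sets_PiM_I_finite)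
    also have "\<dots> = (\<integral>\<^sup>+x. (\<Prod>i\<in>I. f i (x i) * indicator (A i) (x i)) \<partial>PiM I M)"
    proof (rule nn_integral_cong)
      fix x assume "x \<in> space (PiM I M)"
      then have "indicator (Pi\<^sub>E I A) x = (\<Prod>i\<in>I. indicator (A i) (x i) :: ennreal)"
        using I by (auto simp: indicator_def space_PiM PiE_iff prod_zero_iff)
      then show "(\<Prod>i\<in>I. f i (x i)) * indicator (Pi\<^sub>E I A) x = (\<Prod>i\<in>I. f i (x i) * indicator (A i) (x i))"
        by (simp add: prod.distrib)
    qed
    also have "\<dots> = (\<Prod>i\<in>I. \<integral>\<^sup>+x. f i x * indicator (A i) x \<partial>M i)"
      using I by (intro M.product_nn_integral_prod) auto
    also have "\<dots> = (\<Prod>i\<in>I. emeasure (density (M i) (f i)) (A i))"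
      by (intro prod.cong refl) (simp add: emeasure_density)
    finally show "emeasure (density (PiM I M) (\<lambda>x. \<Prod>i\<in>I. f i (x i))) (Pi\<^sub>E I A) =
      (\<Prod>i\<in>I. emeasure (density (M i) (f i)) (A i))" .
  qed
qed

subsection \<open>Independent samples\<close>

lemma prod_ennreal_exp: "(\<Prod>i\<in>I. ennreal (exp (g i))) = ennreal (exp (\<Sum>i\<in>I. g i))"
proof (cases "finite I")
  case True
  then show ?thesis by (simp add: prod_ennreal exp_sum)
qed simp

abbreviation mvn_sample :: "nat \<Rightarrow> nat \<Rightarrow> (nat \<Rightarrow> real) \<Rightarrow> real mat \<Rightarrow> (nat \<Rightarrow> nat \<Rightarrow> real) measure" where
  "mvn_sample n d \<theta> S \<equiv> PiM {..<n} (\<lambda>_. mvn d \<theta> S)"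

lemma sets_mvn_sample: "sets (mvn_sample n d \<theta> S) = sets (PiM {..<n} (\<lambda>_. Rd d))"
  by (intro sets_PiM_cong) auto

lemma prob_space_mvn_sample: "S \<in> spd_mats d \<Longrightarrow> prob_space (mvn_sample n d \<theta> S)"
  by (intro prob_space_PiM prob_space_mvn)

lemma sample_component_measurable:
  assumes "i < n" "j < d"
  shows "(\<lambda>x. x i j) \<in> borel_measurable (mvn_sample n d \<theta> S)"
  using measurable_compose[OF measurable_component_singleton[of i "{..<n}" "\<lambda>_. mvn d \<theta> S"]
      mvn_component_measurable[OF assms(2)]] assms(1) by simp

lemma mvn_sample_mgf:
  assumes S: "S \<in> spd_mats d" and j: "j < d"
  shows "(\<integral>\<^sup>+x. ennreal (exp (\<Sum>i<n. l * (x i j - \<theta> j))) \<partial>mvn_sample n d \<theta> S)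
    = ennreal (exp (real n * (l\<^sup>2 * S $$ (j, j) / 2)))"
proof -
  note [measurable] = mvn_component_measurable[OF j]
  interpret product_sigma_finite "\<lambda>_::nat. mvn d \<theta> S"
    using prob_space_mvn[OF S]
    by (simp add: product_sigma_finite_def prob_space_imp_sigma_finite)
  have "(\<integral>\<^sup>+x. ennreal (exp (\<Sum>i<n. l * (x i j - \<theta> j))) \<partial>mvn_sample n d \<theta> S)
      = (\<integral>\<^sup>+x. (\<Prod>i<n. ennreal (exp (l * (x i j - \<theta> j)))) \<partial>mvn_sample n d \<theta> S)"
    by (simp add: prod_ennreal_exp)
  also have "\<dots> = (\<Prod>i<n. \<integral>\<^sup>+x. ennreal (exp (l * (x j - \<theta> j))) \<partial>mvn d \<theta> S)"
    by (intro product_nn_integral_prod) auto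
  also have "\<dots> = ennreal (exp (real n * (l\<^sup>2 * S $$ (j, j) / 2)))"
    unfolding mvn_mgf[OF S j] by (subst prod_ennreal_exp) simp
  finally show ?thesis .
qed

text \<open>Markov's inequality for the exponential. The factor \<open>l\<close> stands inside the
  event, so a negative \<open>l\<close> covers the lower tail.\<close>

lemma mvn_sample_chernoff:
  assumes S: "S \<in> spd_mats d" and j: "j < d"
  shows "measure (mvn_sample n d \<theta> S)
      {x \<in> space (mvn_sample n d \<theta> S). a \<le> (\<Sum>i<n. l * (x i j - \<theta> j))}
    \<le> exp (real n * (l\<^sup>2 * S $$ (j, j) / 2) - a)" (is "measure ?P ?A \<le> _")
proof -
  interpret prob_space ?P by (rule prob_space_mvn_sample[OF S])
  have [measurable]: "(\<lambda>x. x i j) \<in> borel_measurable ?P" if "i \<in> {..<n}" for i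
    using that j by (simp add: sample_component_measurable)
  have [measurable]: "(\<lambda>x. \<Sum>i<n. l * (x i j - \<theta> j)) \<in> borel_measurable ?P" by measurable
  have "emeasure ?P ?A = (\<integral>\<^sup>+x. indicator ?A x \<partial>?P)" by simp
  also have "\<dots> \<le> (\<integral>\<^sup>+x. ennreal (exp (- a)) * ennreal (exp (\<Sum>i<n. l * (x i j - \<theta> j))) \<partial>?P)"
    by (intro nn_integral_mono)
       (auto simp: indicator_def ennreal_mult[symmetric] exp_add[symmetric])
  also have "\<dots> = ennreal (exp (- a)) * ennreal (exp (real n * (l\<^sup>2 * S $$ (j, j) / 2)))"
    by (subst nn_integral_cmult) (simp_all add: mvn_sample_mgf[OF S j])
  also have "\<dots> = ennreal (exp (real n * (l\<^sup>2 * S $$ (j, j) / 2) - a))"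
    by (simp add: ennreal_mult[symmetric] exp_add[symmetric])
  finally show ?thesis by (simp add: emeasure_eq_measure)
qed

lemma sample_mean_tail:
  assumes S: "S \<in> spd_mats d" and j: "j < d" and v: "S $$ (j, j) \<le> \<sigma>\<^sup>2" "\<sigma> > 0"
    and n: "n \<ge> 1" and t: "t > 0"
  shows "measure (mvn_sample n d \<theta> S)
      {x \<in> space (mvn_sample n d \<theta> S). t < \<bar>(\<Sum>i<n. x i j) / real n - \<theta> j\<bar>}
    \<le> 2 * exp (- (real n * t\<^sup>2 / (2 * \<sigma>\<^sup>2)))" (is "measure ?P ?A \<le> _")
proof -
  interpret prob_space ?P by (rule prob_space_mvn_sample[OF S])
  have [measurable]: "(\<lambda>x. x i j) \<in> borel_measurable ?P" if "i \<in> {..<n}" for i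
    using that j by (simp add: sample_component_measurable)
  \<comment> \<open>The exponent \<open>n * l^2 * \<sigma>^2 / 2 - l * n * t\<close> is least at
    \<open>l = t / \<sigma>^2\<close>, and \<open>a\<close> is \<open>l * n * t\<close> for this
    \<open>l\<close>. The opposite sign of \<open>l\<close> serves the other tail.\<close>
  define a where "a = real n * t\<^sup>2 / \<sigma>\<^sup>2"
  define B where "B l = {x \<in> space ?P. a \<le> (\<Sum>i<n. l * (x i j - \<theta> j))}" for l
  have [measurable]: "B l \<in> events" for l unfolding B_def by measurable
  have B: "prob (B l) \<le> exp (- (real n * t\<^sup>2 / (2 * \<sigma>\<^sup>2)))" if "l\<^sup>2 = (t / \<sigma>\<^sup>2)\<^sup>2" for l
  proof -
    have "l\<^sup>2 * S $$ (j, j) / 2 \<le> (t / \<sigma>\<^sup>2)\<^sup>2 * \<sigma>\<^sup>2 / 2"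
      unfolding that using v(1) by (intro divide_right_mono mult_left_mono) auto
    also have "\<dots> = t\<^sup>2 / (2 * \<sigma>\<^sup>2)"
      using v(2) by (simp add: power2_eq_square field_simps)
    finally have "real n * (l\<^sup>2 * S $$ (j, j) / 2) \<le> real n * (t\<^sup>2 / (2 * \<sigma>\<^sup>2))"
      by (rule mult_left_mono) simp
    then have "real n * (l\<^sup>2 * S $$ (j, j) / 2) - a \<le> - (real n * t\<^sup>2 / (2 * \<sigma>\<^sup>2))"
      by (simp add: a_def)
    moreover have "prob (B l) \<le> exp (real n * (l\<^sup>2 * S $$ (j, j) / 2) - a)"
      unfolding B_def by (rule mvn_sample_chernoff[OF S j])
    ultimately show ?thesis by (meson exp_le_cancel_iff order_trans)
  qed
  have "?A \<subseteq> B (t / \<sigma>\<^sup>2) \<union> B (- (t / \<sigma>\<^sup>2))"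
  proof
    fix x assume x: "x \<in> ?A"
    define m where "m = (\<Sum>i<n. x i j) / real n - \<theta> j"
    have m: "(\<Sum>i<n. l * (x i j - \<theta> j)) = l * (real n * m)" for l
      using n by (simp add: sum_distrib_left[symmetric] sum_subtractf m_def field_simps)
    have a: "a = t / \<sigma>\<^sup>2 * (real n * t)" by (simp add: a_def power2_eq_square)
    have "t / \<sigma>\<^sup>2 > 0" using t v by simp
    then have "a \<le> t / \<sigma>\<^sup>2 * (real n * m)" if "t < m"
      unfolding a using that by (intro mult_left_mono) auto
    moreover have "a \<le> t / \<sigma>\<^sup>2 * (real n * (- m))" if "t < - m"
      unfolding a using that \<open>t / \<sigma>\<^sup>2 > 0\<close> by (intro mult_left_mono) auto
    moreover have "t < m \<or> t < - m" using x by (auto simp: m_def)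
    moreover have "x \<in> B l \<longleftrightarrow> a \<le> l * (real n * m)" for l
      unfolding B_def mem_Collect_eq m using x by auto
    ultimately show "x \<in> B (t / \<sigma>\<^sup>2) \<union> B (- (t / \<sigma>\<^sup>2))"
      by auto
  qed
  then have "prob ?A \<le> prob (B (t / \<sigma>\<^sup>2) \<union> B (- (t / \<sigma>\<^sup>2)))"
    by (rule finite_measure_mono) auto
  also have "\<dots> \<le> prob (B (t / \<sigma>\<^sup>2)) + prob (B (- (t / \<sigma>\<^sup>2)))"
    by (rule measure_Un_le) auto
  also have "\<dots> \<le> 2 * exp (- (real n * t\<^sup>2 / (2 * \<sigma>\<^sup>2)))"
    using B[of "t / \<sigma>\<^sup>2"] B[of "- (t / \<sigma>\<^sup>2)"] by simp
  finally show ?thesis .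
qed

lemma mvn_sample_tilt:
  assumes S: "S \<in> spd_mats d" and j: "j < d"
  shows "mvn_sample n d (\<lambda>i. \<theta> i + l * S $$ (i, j)) S = density (mvn_sample n d \<theta> S)
    (\<lambda>x. ennreal (exp (\<Sum>i<n. l * (x i j - \<theta> j) - l\<^sup>2 * S $$ (j, j) / 2)))"
proof -
  note [measurable] = mvn_component_measurable[OF j]
  show ?thesis
    unfolding mvn_tilt[OF S j] prod_ennreal_exp[symmetric]
    by (subst density_PiM)
       (auto simp: mvn_tilt[OF S j, symmetric] prob_space_mvn[OF S])
qed

text \<open>A set that is unlikely under \<open>?P\<close> stays unlikely under the tilt unless the
  likelihood ratio \<open>L\<close> has a large second moment. The bound on \<open>L\<close> is
  integrated over \<open>A\<close>, with the quadratic term enlarged to the whole space.\<close>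

lemma mvn_sample_change_of_measure:
  assumes S: "S \<in> spd_mats d" and j: "j < d" and K: "K > 0"
    and A: "A \<in> sets (mvn_sample n d \<theta> S)"
  shows "measure (mvn_sample n d (\<lambda>i. \<theta> i + l * S $$ (i, j)) S) A
    \<le> (exp (real n * (l\<^sup>2 * S $$ (j, j))) / K + K * measure (mvn_sample n d \<theta> S) A) / 2"
    (is "measure ?Q A \<le> (?E / K + K * measure ?P A) / 2")
proof -
  interpret P: prob_space ?P by (rule prob_space_mvn_sample[OF S])
  interpret Q: prob_space ?Q by (rule prob_space_mvn_sample[OF S])
  note [measurable] = A
  have [measurable]: "(\<lambda>x. x i j) \<in> borel_measurable ?P" if "i \<in> {..<n}" for i
    using that j by (simp add: sample_component_measurable)
  define v where "v = l\<^sup>2 * S $$ (j, j)"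
  define L where "L x = exp (\<Sum>i<n. l * (x i j - \<theta> j) - v / 2)" for x
  define G where "G x = exp (\<Sum>i<n. (2 * l) * (x i j - \<theta> j))" for x :: "nat \<Rightarrow> nat \<Rightarrow> real"
  have [measurable]: "L \<in> borel_measurable ?P" "G \<in> borel_measurable ?P"
    unfolding L_def G_def by measurable
  \<comment> \<open>Squaring doubles the tilt, so the second moment of \<open>L\<close> is again a
    moment generating function: \<open>exp (- n * v)\<close> times
    \<open>exp (2 * n * v)\<close>.\<close>
  have L2: "(L x)\<^sup>2 = exp (- (real n * v)) * G x" for x
    by (simp add: L_def G_def power2_eq_square exp_add[symmetric] sum_subtractf
        sum_distrib_left sum.distrib[symmetric] mult_ac)
  have G_int: "(\<integral>\<^sup>+x. ennreal (G x) \<partial>?P) = ennreal (exp (real n * ((2 * l)\<^sup>2 * S $$ (j, j) / 2)))"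
    unfolding G_def by (rule mvn_sample_mgf[OF S j])
  have "emeasure ?Q A = (\<integral>\<^sup>+x. ennreal (L x) * indicator A x \<partial>?P)"
    unfolding mvn_sample_tilt[OF S j] L_def v_def by (subst emeasure_density) auto
  also have "\<dots> \<le> (\<integral>\<^sup>+x. ennreal (exp (- (real n * v)) / (2 * K)) * ennreal (G x)
      + ennreal (K / 2) * indicator A x \<partial>?P)"
  proof (intro nn_integral_mono)
    fix x
    \<comment> \<open>AM-GM replaces Cauchy--Schwarz for \<open>L \<cdot> 1\<^sub>A\<close>; the optimal \<open>K\<close> is left to the caller.\<close>
    have "0 \<le> (L x - K)\<^sup>2" by simp
    then have "L x \<le> (L x)\<^sup>2 / (2 * K) + K / 2"
      using K by (simp add: power2_eq_square field_simps)
    then have "L x \<le> exp (- (real n * v)) / (2 * K) * G x + K / 2"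
      by (simp add: L2)
    then have "ennreal (L x) \<le> ennreal (exp (- (real n * v)) / (2 * K)) * ennreal (G x) + ennreal (K / 2)"
      using K by (simp add: ennreal_mult[symmetric] ennreal_plus[symmetric] G_def ennreal_leI
          del: ennreal_plus)
    then show "ennreal (L x) * indicator A x \<le> ennreal (exp (- (real n * v)) / (2 * K)) * ennreal (G x)
      + ennreal (K / 2) * indicator A x"
      by (auto simp: indicator_def)
  qed
  also have "\<dots> = ennreal (exp (- (real n * v)) / (2 * K)) * ennreal (exp (real n * ((2 * l)\<^sup>2 * S $$ (j, j) / 2)))
      + ennreal (K / 2) * emeasure ?P A"
    unfolding G_int[symmetric] by (simp add: nn_integral_add nn_integral_cmult)
  also have "(2 * l)\<^sup>2 * S $$ (j, j) / 2 = 2 * v" by (simp add: v_def power2_eq_square)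
  also have "ennreal (exp (- (real n * v)) / (2 * K)) * ennreal (exp (real n * (2 * v))) = ennreal (exp (real n * v) / (2 * K))"
    using K by (simp add: ennreal_mult[symmetric] exp_add[symmetric] mult_ac)
  also have "ennreal (exp (real n * v) / (2 * K)) + ennreal (K / 2) * emeasure ?P A
      = ennreal ((?E / K + K * measure ?P A) / 2)"
    using K by (simp add: P.emeasure_eq_measure ennreal_mult[symmetric] v_def add_divide_distrib
        ennreal_plus[symmetric] del: ennreal_plus)
  finally show ?thesis
    using K by (simp add: Q.emeasure_eq_measure)
qed

subsection \<open>The minimax quantile\<close>

lemma vec_sup_norm_le_iff:
  assumes "d \<ge> 1"
  shows "vec_sup_norm d v \<le> r \<longleftrightarrow> (\<forall>j<d. \<bar>v j\<bar> \<le> r)"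
  unfolding vec_sup_norm_def using assms by (subst Max_le_iff) (auto simp: lessThan_empty_iff)

lemma vec_sup_norm_less_iff:
  assumes "d \<ge> 1"
  shows "vec_sup_norm d v < r \<longleftrightarrow> (\<forall>j<d. \<bar>v j\<bar> < r)"
  unfolding vec_sup_norm_def using assms by (subst Max_less_iff) (auto simp: lessThan_empty_iff)

lemma mat_max_norm_le_iff:
  assumes "d \<ge> 1"
  shows "mat_max_norm d S \<le> r \<longleftrightarrow> (\<forall>i<d. \<forall>j<d. \<bar>S $$ (i, j)\<bar> \<le> r)"
proof -
  have "(\<lambda>(i, j). \<bar>S $$ (i, j)\<bar>) ` ({..<d} \<times> {..<d}) \<noteq> {}" using assms by (auto simp: lessThan_empty_iff)
  then show ?thesis unfolding mat_max_norm_def by (subst Max_le_iff) (auto simp: lessThan_empty_iff)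
qed

section \<open>Upper bound through the sample mean\<close>

abbreviation sup_loss :: "nat \<Rightarrow> (nat \<Rightarrow> real) \<Rightarrow> (nat \<Rightarrow> real) \<Rightarrow> real" where
  "sup_loss d \<theta> \<theta>' \<equiv> vec_sup_norm d (\<lambda>j. \<theta> j - \<theta>' j)"

text \<open>Restricted to \<open>{..<d}\<close> because an estimator must take values in the
  extensional functions that form \<open>Rd d\<close>.\<close>

definition sample_mean :: "nat \<Rightarrow> nat \<Rightarrow> (nat \<Rightarrow> nat \<Rightarrow> real) \<Rightarrow> nat \<Rightarrow> real" where
  "sample_mean n d x = (\<lambda>j\<in>{..<d}. (\<Sum>i<n. x i j) / real n)"

lemma sample_mean_measurable: "sample_mean n d \<in> measurable (PiM {..<n} (\<lambda>_. Rd d)) (Rd d)"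
  unfolding sample_mean_def
proof (rule measurable_restrict)
  fix j assume j: "j \<in> {..<d}"
  have [measurable]: "(\<lambda>x. x i j) \<in> borel_measurable (PiM {..<n} (\<lambda>_. Rd d))" if "i \<in> {..<n}" for i
    using measurable_compose[OF measurable_component_singleton[OF that, of "\<lambda>_. Rd d"]
        measurable_component_singleton[OF j, of "\<lambda>_. borel"]] .
  show "(\<lambda>x. (\<Sum>i<n. x i j) / real n) \<in> borel_measurable (PiM {..<n} (\<lambda>_. Rd d))"
    by measurable
qed

lemma minimax_quantile_upper:
  assumes n: "n \<ge> 1" and d: "d \<ge> 1" and \<sigma>: "\<sigma> > 0" and \<delta>: "0 < \<delta>" "\<delta> \<le> 1 / 4"
  shows "minimax_quantile \<delta> (PiM {..<n} (\<lambda>_. Rd d)) (Rd d) (gaussian_family n d \<sigma>) (sup_loss d)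
    \<le> ennreal (2 * (\<sigma> * sqrt (ln (real d / \<delta>) / real n)))"
proof -
  define x where "x = real d / \<delta>"
  have x4: "x \<ge> 4" using d \<delta> by (simp add: x_def field_simps)
  \<comment> \<open>The factor 2 makes the exponent of the tail bound \<open>2 * ln x\<close>: each
    coordinate then fails with probability at most \<open>2 / x^2\<close>.\<close>
  define t where "t = 2 * (\<sigma> * sqrt (ln x / real n))"
  have lnx: "ln x > 0" using x4 by simp
  have t: "t > 0" using n \<sigma> lnx by (simp add: t_def)
  have "real n * t\<^sup>2 / (2 * \<sigma>\<^sup>2) = 2 * ln x"
    using n \<sigma> lnx by (simp add: t_def power_mult_distrib)
  then have "exp (- (real n * t\<^sup>2 / (2 * \<sigma>\<^sup>2))) = exp (- ln x + - ln x)" by simp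
  also have "\<dots> = exp (- ln x) * exp (- ln x)" by (rule exp_add)
  also have "\<dots> = 1 / x\<^sup>2"
    using x4 by (simp add: exp_minus power2_eq_square divide_inverse)
  finally have tail: "exp (- (real n * t\<^sup>2 / (2 * \<sigma>\<^sup>2))) = 1 / x\<^sup>2" .
  have "loss_quantile \<delta> P (sup_loss d) (sample_mean n d) \<theta> \<le> ennreal t"
    if "P \<in> gaussian_family n d \<sigma> \<theta>" for P \<theta>
  proof -
    from that obtain S where P: "P = mvn_sample n d \<theta> S" and S: "S \<in> spd_mats d"
      and v: "mat_max_norm d S \<le> \<sigma>\<^sup>2"
      by (auto simp: gaussian_family_def)
    interpret prob_space P unfolding P by (rule prob_space_mvn_sample[OF S])
    define T where "T j = {x \<in> space P. t < \<bar>(\<Sum>i<n. x i j) / real n - \<theta> j\<bar>}" for j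
    have T [measurable]: "T j \<in> events" if "j \<in> {..<d}" for j
    proof -
      have [measurable]: "(\<lambda>x. x i j) \<in> borel_measurable P" if "i \<in> {..<n}" for i
        using that \<open>j \<in> {..<d}\<close> unfolding P by (simp add: sample_component_measurable)
      show ?thesis unfolding T_def by measurable
    qed
    have probT: "prob (T j) \<le> 2 * (1 / x\<^sup>2)" if "j \<in> {..<d}" for j
    proof -
      have "\<bar>S $$ (j, j)\<bar> \<le> \<sigma>\<^sup>2"
        using v d that by (simp add: mat_max_norm_le_iff)
      then show ?thesis
        using sample_mean_tail[OF S _ _ \<sigma> n t, of j \<theta>] that unfolding tail T_def P by auto
    qed
    have "prob (\<Union>j<d. T j) \<le> (\<Sum>j<d. prob (T j))"
      by (rule finite_measure_subadditive_finite) auto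
    also have "\<dots> \<le> (\<Sum>j<d. 2 * (1 / x\<^sup>2))" by (intro sum_mono probT)
    \<comment> \<open>Since \<open>d / x = \<delta>\<close>, the union over \<open>d\<close>
      coordinates costs one factor \<open>x\<close>; the remaining \<open>2 / x\<close> is below 1
      because \<open>x \<ge> 4\<close>.\<close>
    also have "\<dots> = \<delta> * (2 / x)"
      using d \<delta> by (simp add: x_def power2_eq_square field_simps)
    also have "\<dots> \<le> \<delta> * 1" using x4 \<delta> by (intro mult_left_mono) auto
    finally have "prob (\<Union>j<d. T j) \<le> \<delta>" by simp
    moreover have "{x \<in> space P. sup_loss d (sample_mean n d x) \<theta> \<le> t} = space P - (\<Union>j<d. T j)"
      using d by (auto simp: vec_sup_norm_le_iff T_def sample_mean_def not_less)
    moreover have "prob (space P - (\<Union>j<d. T j)) = 1 - prob (\<Union>j<d. T j)"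
      by (rule prob_compl) auto
    ultimately have "prob {x \<in> space P. sup_loss d (sample_mean n d x) \<theta> \<le> t} \<ge> 1 - \<delta>"
      by simp
    then show ?thesis
      unfolding loss_quantile_def using t by (intro INF_lower) auto
  qed
  then have "(SUP \<theta>\<in>space (Rd d). SUP P\<in>gaussian_family n d \<sigma> \<theta>.
      loss_quantile \<delta> P (sup_loss d) (sample_mean n d) \<theta>) \<le> ennreal t"
    by (intro SUP_least)
  then show ?thesis
    unfolding minimax_quantile_def t_def x_def
    by (rule INF_lower2[OF sample_mean_measurable])
qed

section \<open>Lower bound through d + 1 separated means\<close>

lemma scaled_identity_spd: "\<sigma> > 0 \<Longrightarrow> \<sigma>\<^sup>2 \<cdot>\<^sub>m 1\<^sub>m d \<in> spd_mats d"
proof -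
  assume \<sigma>: "\<sigma> > 0"
  have "quad_form d (\<sigma>\<^sup>2 \<cdot>\<^sub>m 1\<^sub>m d) y = \<sigma>\<^sup>2 * (\<Sum>i<d. (y i)\<^sup>2)" for y
  proof -
    have "quad_form d (\<sigma>\<^sup>2 \<cdot>\<^sub>m 1\<^sub>m d) y = (\<Sum>i<d. \<Sum>k<d. if i = k then \<sigma>\<^sup>2 * (y i)\<^sup>2 else 0)"
      unfolding quad_form_def by (intro sum.cong refl) (auto simp: power2_eq_square)
    then show ?thesis by (simp add: sum_distrib_left)
  qed
  moreover have "0 < (\<Sum>i<d. (y i)\<^sup>2)" if "i < d" "y i \<noteq> 0" for y :: "nat \<Rightarrow> real" and i
    using that by (intro sum_pos2[of _ i]) auto
  ultimately show ?thesis using \<sigma> by (auto simp: spd_mats_iff)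
qed

text \<open>An infimum below \<open>r\<close> has an admissible level below \<open>r\<close>.
  Passing to the strict event \<open>L < r\<close> keeps the probability bound and makes events
  around centres at distance \<open>2 * r\<close> disjoint.\<close>

lemma loss_quantile_less_imp:
  assumes "prob_space P" "loss_quantile \<delta> P L est \<theta> < ennreal r"
    and "{x \<in> space P. L (est x) \<theta> < r} \<in> sets P"
  shows "1 - \<delta> \<le> measure P {x \<in> space P. L (est x) \<theta> < r}"
proof -
  interpret prob_space P by fact
  obtain s where s: "0 \<le> s" "1 - \<delta> \<le> prob {x \<in> space P. L (est x) \<theta> \<le> s}" "ennreal s < ennreal r"
    using assms(2) by (auto simp: loss_quantile_def INF_less_iff)
  have "prob {x \<in> space P. L (est x) \<theta> \<le> s} \<le> prob {x \<in> space P. L (est x) \<theta> < r}"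
    using s assms(3) by (intro finite_measure_mono) (auto simp: ennreal_less_iff)
  then show ?thesis using s(2) by simp
qed

lemma minimax_quantile_lower:
  assumes n: "n \<ge> 1" and d: "d \<ge> 1" and \<sigma>: "\<sigma> > 0" and \<delta>: "0 < \<delta>" "\<delta> \<le> 1 / 4"
  shows "ennreal (1 / 4 * (\<sigma> * sqrt (ln (real d / \<delta>) / real n)))
    \<le> minimax_quantile \<delta> (PiM {..<n} (\<lambda>_. Rd d)) (Rd d) (gaussian_family n d \<sigma>) (sup_loss d)"
proof -
  define x where "x = real d / \<delta>"
  have x4: "x \<ge> 4" using d \<delta> by (simp add: x_def field_simps)
  \<comment> \<open>With the factor \<open>1 / 4\<close> the exponent
    \<open>n * (2 * r)^2 / \<sigma>^2\<close> of the second moment becomes \<open>ln x / 4\<close>,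
    so this moment is the fourth root of \<open>x\<close>.\<close>
  define r where "r = 1 / 4 * (\<sigma> * sqrt (ln x / real n))"
  have lnx: "ln x > 0" using x4 by simp
  have r: "r > 0" using n \<sigma> lnx by (simp add: r_def)
  define l where "l = 2 * r / \<sigma>\<^sup>2"
  define S where "S = \<sigma>\<^sup>2 \<cdot>\<^sub>m (1\<^sub>m d :: real mat)"
  have S: "S \<in> spd_mats d" unfolding S_def by (rule scaled_identity_spd[OF \<sigma>])
  have normS: "mat_max_norm d S \<le> \<sigma>\<^sup>2" using d by (auto simp: mat_max_norm_le_iff S_def)
  define \<theta> where "\<theta> j = (\<lambda>i\<in>{..<d}. if i = j then 2 * r else 0)" for j
  define z where "z = (\<lambda>i\<in>{..<d}. 0 :: real)"
  define P where "P \<theta> = mvn_sample n d \<theta> S" for \<theta>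
  \<comment> \<open>As \<open>S\<close> is diagonal, tilting by \<open>l\<close> in coordinate
    \<open>j\<close> moves the mean by \<open>l * \<sigma>^2 = 2 * r\<close> in that coordinate
    alone.\<close>
  have shift: "P (\<theta> j) = mvn_sample n d (\<lambda>i. z i + l * S $$ (i, j)) S" if "j < d" for j
  proof -
    have "mvn d (\<theta> j) S = mvn d (\<lambda>i. z i + l * S $$ (i, j)) S"
      by (rule mvn_cong) (use that \<sigma> in \<open>auto simp: \<theta>_def z_def l_def S_def\<close>)
    then show ?thesis by (simp add: P_def)
  qed
  have expo: "exp (real n * (l\<^sup>2 * S $$ (j, j))) = sqrt (sqrt x)" if "j < d" for j
  proof -
    have "real n * (l\<^sup>2 * S $$ (j, j)) = real n * (4 * r\<^sup>2 / \<sigma>\<^sup>2)"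
      using that \<sigma> by (simp add: S_def l_def power2_eq_square field_simps)
    also have "\<dots> = ln x / 4"
      using n \<sigma> lnx by (simp add: r_def power_mult_distrib power_divide)
    also have "\<dots> = ln (sqrt (sqrt x))" using x4 by (simp add: ln_sqrt)
    finally show ?thesis using x4 by simp
  qed
  have "ennreal r \<le> (SUP \<theta>\<in>space (Rd d). SUP P\<in>gaussian_family n d \<sigma> \<theta>.
      loss_quantile \<delta> P (sup_loss d) est \<theta>)"
    if est: "est \<in> measurable (PiM {..<n} (\<lambda>_. Rd d)) (Rd d)" for est
  proof (rule ccontr)
    assume "\<not> ?thesis"
    then have less: "(SUP \<theta>\<in>space (Rd d). SUP P\<in>gaussian_family n d \<sigma> \<theta>.
      loss_quantile \<delta> P (sup_loss d) est \<theta>) < ennreal r" by simp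
    \<comment> \<open>The event lives in the common sample space, so that the same set can be
      measured under every \<open>P \<eta>'\<close>.\<close>
    define A where "A \<eta> = {x \<in> space (PiM {..<n} (\<lambda>_. Rd d)). sup_loss d (est x) \<eta> < r}" for \<eta>
    have sets: "sets (P \<eta>) = sets (PiM {..<n} (\<lambda>_. Rd d))" for \<eta>
      unfolding P_def by (rule sets_mvn_sample)
    note space = sets_eq_imp_space_eq[OF sets]
    have A: "A \<eta> \<in> sets (P \<eta>')" for \<eta> \<eta>'
    proof -
      have [measurable]: "(\<lambda>x. est x j) \<in> borel_measurable (PiM {..<n} (\<lambda>_. Rd d))" if "j \<in> {..<d}" for j
        using measurable_compose[OF est measurable_component_singleton[OF that, of "\<lambda>_. borel"]] .
      have "A \<eta> = {x \<in> space (PiM {..<n} (\<lambda>_. Rd d)). \<forall>j\<in>{..<d}. \<bar>est x j - \<eta> j\<bar> < r}"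
        using d by (auto simp: A_def vec_sup_norm_less_iff)
      also have "\<dots> \<in> sets (PiM {..<n} (\<lambda>_. Rd d))" by measurable
      finally show ?thesis by (simp only: sets)
    qed
    have prob_space: "prob_space (P \<eta>)" for \<eta>
      unfolding P_def by (rule prob_space_mvn_sample[OF S])
    have acc: "1 - \<delta> \<le> measure (P \<eta>) (A \<eta>)" if "\<eta> \<in> space (Rd d)" for \<eta>
    proof -
      have "P \<eta> \<in> gaussian_family n d \<sigma> \<eta>"
        using S normS by (auto simp: gaussian_family_def P_def)
      then have "loss_quantile \<delta> (P \<eta>) (sup_loss d) est \<eta> \<le>
          (SUP \<theta>\<in>space (Rd d). SUP P\<in>gaussian_family n d \<sigma> \<theta>. loss_quantile \<delta> P (sup_loss d) est \<theta>)"
        using that by (intro SUP_upper2[OF that] SUP_upper)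
      from loss_quantile_less_imp[OF prob_space le_less_trans[OF this less]]
      show ?thesis using A[of \<eta> \<eta>] by (simp add: A_def space)
    qed
    have params: "\<theta> j \<in> space (Rd d)" "z \<in> space (Rd d)" for j
      by (simp_all add: space_PiM \<theta>_def z_def)
    interpret Z: prob_space "P z" by (rule prob_space)
    have sep: "A (\<theta> j) \<inter> A z = {}" "k < d \<Longrightarrow> k \<noteq> j \<Longrightarrow> A (\<theta> j) \<inter> A (\<theta> k) = {}" if j: "j < d" for j k
    proof -
      have far: "A \<eta> \<inter> A \<eta>' = {}" if "\<bar>\<eta> j - \<eta>' j\<bar> \<ge> 2 * r" for \<eta> \<eta>'
      proof -
        have False if "x \<in> A \<eta>" "x \<in> A \<eta>'" for x
        proof -
          have "\<bar>est x j - \<eta> j\<bar> < r" "\<bar>est x j - \<eta>' j\<bar> < r"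
            using that d j by (auto simp: A_def vec_sup_norm_less_iff)
          then show False using \<open>\<bar>\<eta> j - \<eta>' j\<bar> \<ge> 2 * r\<close> by linarith
        qed
        then show ?thesis by blast
      qed
      show "A (\<theta> j) \<inter> A z = {}" by (rule far) (use j in \<open>simp add: \<theta>_def z_def\<close>)
      show "A (\<theta> j) \<inter> A (\<theta> k) = {}" if "k < d" "k \<noteq> j"
        by (rule far) (use that j in \<open>simp add: \<theta>_def\<close>)
    qed
    have "(\<Sum>j<d. Z.prob (A (\<theta> j))) = Z.prob (\<Union>j<d. A (\<theta> j))"
      by (rule Z.finite_measure_finite_Union[symmetric])
         (use A sep(2) in \<open>auto simp: disjoint_family_on_def\<close>)
    also have "\<dots> \<le> Z.prob (space (P z) - A z)"
      using A[of _ z] sep(1) sets.sets_into_space[OF A[of _ z]]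
      by (intro Z.finite_measure_mono) blast+
    also have "\<dots> = 1 - Z.prob (A z)" by (rule Z.prob_compl[OF A])
    also have "\<dots> \<le> \<delta>" using acc[OF params(2)] by simp
    finally have sum: "(\<Sum>j<d. Z.prob (A (\<theta> j))) \<le> \<delta>" .
    \<comment> \<open>Pigeonhole: \<open>d\<close> disjoint events share the probability
      \<open>\<delta>\<close>, and \<open>\<delta> / d = 1 / x\<close>. The strict sum needs a
      nonempty index set.\<close>
    have "\<exists>j<d. Z.prob (A (\<theta> j)) \<le> 1 / x"
    proof (rule ccontr)
      assume "\<not> ?thesis"
      then have "(\<Sum>j<d. 1 / x) < (\<Sum>j<d. Z.prob (A (\<theta> j)))"
        using d by (intro sum_strict_mono) (auto simp: not_le lessThan_empty_iff)
      moreover have "(\<Sum>j<d. 1 / x) = \<delta>" using d \<delta> by (simp add: x_def)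
      ultimately show False using sum by simp
    qed
    then obtain j where j: "j < d" and small: "Z.prob (A (\<theta> j)) \<le> 1 / x" by blast
    \<comment> \<open>By the choice of \<open>r\<close> the second moment of the likelihood ratio is \<open>q\<close>; take \<open>K = q\<^sup>2 = sqrt x\<close>.\<close>
    define q where "q = sqrt (sqrt x)"
    have q: "q > 0" "q\<^sup>2 = sqrt x" "x = q\<^sup>2 * q\<^sup>2" using x4 by (simp_all add: q_def)
    have "measure (P (\<theta> j)) (A (\<theta> j)) \<le>
        (exp (real n * (l\<^sup>2 * S $$ (j, j))) / q\<^sup>2 + q\<^sup>2 * measure (P z) (A (\<theta> j))) / 2"
      unfolding shift[OF j] unfolding P_def
      by (rule mvn_sample_change_of_measure[OF S j]) (use q A[of "\<theta> j" z] in \<open>simp_all add: P_def\<close>)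
    also have "\<dots> \<le> (q / q\<^sup>2 + q\<^sup>2 * (1 / x)) / 2"
      unfolding expo[OF j] q_def[symmetric]
      using small q(1) by (intro divide_right_mono add_left_mono mult_left_mono) auto
    also have "\<dots> = (1 / q + 1 / q\<^sup>2) / 2"
      using q by (simp add: power2_eq_square)
    \<comment> \<open>The target is \<open>3 / 4\<close> because \<open>1 - \<delta>\<close> is at
      least that. From \<open>x \<ge> 4\<close> follows \<open>q^2 \<ge> 2 > (5 / 4)^2\<close>, so
      the mean is below \<open>(4 / 5 + 1 / 2) / 2\<close>.\<close>
    also have "\<dots> < 3 / 4"
    proof -
      have "sqrt x \<ge> 2" using x4 by (simp add: real_le_rsqrt)
      then have q2: "q\<^sup>2 \<ge> 2" by (simp only: q(2))
      have "q > 5 / 4"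
        by (rule power2_less_imp_less) (use q2 q(1) in \<open>auto simp: power2_eq_square\<close>)
      then have "1 / q < 4 / 5" using q(1) by (simp add: field_simps)
      moreover have "1 / q\<^sup>2 \<le> 1 / 2" using q2 q(1) by (simp add: field_simps)
      ultimately show ?thesis by simp
    qed
    finally show False using acc[OF params(1), of j] \<delta> by simp
  qed
  then show ?thesis
    unfolding minimax_quantile_def r_def x_def by (intro INF_greatest)
qed

theorem proposition12:
  shows "\<exists>c>0. \<exists>C>0. \<forall>(n::nat) (d::nat) (\<sigma>::real) (\<delta>::real).
    n \<ge> 1 \<longrightarrow> d \<ge> 1 \<longrightarrow> \<sigma> > 0 \<longrightarrow> 0 < \<delta> \<longrightarrow> \<delta> \<le> 1 / 4 \<longrightarrow>
    (let M = minimax_quantile \<delta> (PiM {..<n} (\<lambda>_. Rd d)) (Rd d) (gaussian_family n d \<sigma>)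
               (\<lambda>\<theta> \<theta>'. vec_sup_norm d (\<lambda>j. \<theta> j - \<theta>' j));
         R = \<sigma> * sqrt (ln (real d / \<delta>) / real n)
     in ennreal (c * R) \<le> M \<and> M \<le> ennreal (C * R))"
\<comment> \<open>The witnesses are the factor in the separation radius and the factor in the
  deviation of the sample mean.\<close>
proof (rule exI[of _ "1 / 4"], rule conjI, simp, rule exI[of _ 2], rule conjI, simp, intro allI impI)
  fix n d :: nat and \<sigma> \<delta> :: real
  assume "n \<ge> 1" "d \<ge> 1" "\<sigma> > 0" "0 < \<delta>" "\<delta> \<le> 1 / 4"
  from minimax_quantile_lower[OF this] minimax_quantile_upper[OF this]
  show "let M = minimax_quantile \<delta> (PiM {..<n} (\<lambda>_. Rd d)) (Rd d) (gaussian_family n d \<sigma>)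
               (\<lambda>\<theta> \<theta>'. vec_sup_norm d (\<lambda>j. \<theta> j - \<theta>' j));
         R = \<sigma> * sqrt (ln (real d / \<delta>) / real n)
     in ennreal (1 / 4 * R) \<le> M \<and> M \<le> ennreal (2 * R)"
    unfolding Let_def by blast
qed

end
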